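(* Let $p,n\in\mathbb{N}$, $0\le\mu_1\le\mu_2$ (real numbers), $\alpha\ge0$, $\beta\in\mathbb{R}$, $\alpha+i\beta\neq0$, and $-1\le B_1\le B_2<A_2\le A_1\le 1$. Then $$N_{p,\mu_2}^{n}(\alpha,\beta,A_2,B_2)\subset N_{p,\mu_1}^{n}(\alpha,\beta,A_1,B_1).$$
   Context: $\mathbb{U}=\{z\in\mathbb{C}:|z|<1\}$ and $\mathbb{N}=\{1,2,3,\dots\}$. For $p,n\in\mathbb{N}$, $\mathcal{A}_p$ is the class of functions $f(z)=z^{p}+\sum_{k=n}^{\infty}a_{k+p}z^{k+p}$ that are analytic and $p$-valent in $\mathbb{U}$ ($p$-valent: no value is taken more than $p$ times, counted with multiplicity, and some value is taken exactly $p$ times; in particular $f(z)\neq0$ for $z\in\mathbb{U}\setminus\{0\}$). The function $z^p/f(z)$ is extended by the value $1$ at $z=0$. For $F,G$ analytic in $\mathbb{U}$, $F\prec G$ ($F$ is subordinate to $G$) means there is an analytic $w:\mathbb{U}\to\mathbb{C}$ with $w(0)=0$, $|w(z)|<1$ on $\mathbb{U}$, and $F(z)=G(w(z))$ for all $z\in\mathbb{U}$. For $\mu\in\mathbb{C}$, $\alpha\ge0$, $\beta\in\mathbb{R}$, $-1\le B\le1$, $A\in\mathbb{R}$, $A\ne B$, $N_{p,\mu}^{n}(\alpha,\beta,A,B)$ is the class of $f\in\mathcal{A}_p$ such that $$(1+\mu)\left(\frac{z^{p}}{f(z)}\right)^{\alpha+i\beta}-\mu\left(\frac{zf'(z)}{pf(z)}\right)\left(\frac{z^{p}}{f(z)}\right)^{\alpha+i\beta}\prec\frac{1+Az}{1+Bz}\quad(z\in\mathbb{U}).$$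 All powers are principal values (so $(z^p/f(z))^{\alpha+i\beta}$ equals $1$ at $z=0$), and it is part of the convention that $(z^p/f(z))^{\alpha+i\beta}$ is analytic in $\mathbb{U}$. *)

theory Defs
  imports "HOL-Complex_Analysis.Complex_Analysis"
begin

abbreviation unit_disc :: "complex set" where
  "unit_disc \<equiv> ball 0 1"

text \<open>
  Number of times the value \<open>w\<close> is taken in the unit disc, counted with multiplicity.
  This is only meaningful if the fibre is finite (the sum over an infinite set is 0);
  for a finite fibre of a holomorphic function, every point of it is an isolated zero of
  \<open>f - w\<close>, so that \<^const>\<open>zorder\<close> is the usual multiplicity.
\<close>

definition value_count :: "(complex \<Rightarrow> complex) \<Rightarrow> complex \<Rightarrow> nat" where
  "value_count f w =
     (\<Sum>z \<in> {z \<in> unit_disc. f z = w}. nat (zorder (\<lambda>\<zeta>. f \<zeta> - w) z))"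

definition p_valent :: "nat \<Rightarrow> (complex \<Rightarrow> complex) \<Rightarrow> bool" where
  "p_valent p f \<longleftrightarrow>
     (\<forall>w. finite {z \<in> unit_disc. f z = w} \<and> value_count f w \<le> p) \<and>
     (\<exists>w. value_count f w = p)"

text \<open>
  Functions on the disc are represented by total functions; their values outside the disc
  are irrelevant. The power series below is indexed by \<open>k = n + j\<close>.
\<close>

definition class_A :: "nat \<Rightarrow> nat \<Rightarrow> (complex \<Rightarrow> complex) set" where
  "class_A p n =
     {f. f holomorphic_on unit_disc \<and>
         (\<exists>a :: nat \<Rightarrow> complex. \<forall>z \<in> unit_disc.
            (\<lambda>j. a (n + j + p) * z ^ (n + j + p)) sums (f z - z ^ p)) \<and>
         p_valent p f}"

definition subordinate :: "(complex \<Rightarrow> complex) \<Rightarrow> (complex \<Rightarrow> complex) \<Rightarrow> bool"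
    (infix "\<prec>\<^sub>s" 50) where
  "F \<prec>\<^sub>s G \<longleftrightarrow>
     F holomorphic_on unit_disc \<and> G holomorphic_on unit_disc \<and>
     (\<exists>w. w holomorphic_on unit_disc \<and> w 0 = 0 \<and>
          (\<forall>z \<in> unit_disc. norm (w z) < 1) \<and>
          (\<forall>z \<in> unit_disc. F z = G (w z)))"

text \<open>
  The quotients \<open>z\<^sup>p / f(z)\<close> and \<open>z f'(z) / (p f(z))\<close> both have a removable singularity with
  value 1 at the origin; as division by zero yields 0, this value is put in explicitly.
\<close>

definition pquot :: "nat \<Rightarrow> (complex \<Rightarrow> complex) \<Rightarrow> complex \<Rightarrow> complex" where
  "pquot p f z = (if z = 0 then 1 else z ^ p / f z)"

definition log_deriv_quot :: "nat \<Rightarrow> (complex \<Rightarrow> complex) \<Rightarrow> complex \<Rightarrow> complex" where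
  "log_deriv_quot p f z = (if z = 0 then 1 else z * deriv f z / (of_nat p * f z))"

text \<open>
  The complex \<open>powr\<close> is the principal power. The first condition is the convention that
  the power of \<open>z\<^sup>p / f(z)\<close> is analytic in the disc. The parameters are meant to satisfy
  \<open>p, n \<ge> 1\<close>, \<open>\<alpha> \<ge> 0\<close>, \<open>-1 \<le> B \<le> 1\<close> and \<open>A \<noteq> B\<close>.
\<close>

definition class_N ::
  "nat \<Rightarrow> nat \<Rightarrow> complex \<Rightarrow> real \<Rightarrow> real \<Rightarrow> real \<Rightarrow> real \<Rightarrow> (complex \<Rightarrow> complex) set" where
  "class_N p n \<mu> \<alpha> \<beta> A B =
     {f \<in> class_A p n.
        (\<lambda>z. pquot p f z powr (of_real \<alpha> + \<i> * of_real \<beta>)) holomorphic_on unit_disc \<and>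
        (\<lambda>z. (1 + \<mu>) * pquot p f z powr (of_real \<alpha> + \<i> * of_real \<beta>)
             - \<mu> * log_deriv_quot p f z * pquot p f z powr (of_real \<alpha> + \<i> * of_real \<beta>))
        \<prec>\<^sub>s (\<lambda>z. (1 + of_real A * z) / (1 + of_real B * z))}"

end

theory Submission
  imports Defs
begin

text \<open>
  Put \<open>\<kappa> = \<alpha> + \<i>\<beta>\<close> and \<open>g(z) = (z\<^sup>p / f(z))\<^sup>\<kappa>\<close>. Logarithmic differentiation turns the expression
  defining the class into \<open>g + (\<mu> / (\<kappa> p)) z g'\<close>, where \<open>\<mu> / (\<kappa> p)\<close> has nonnegative real part.
  The image of the disc under \<open>(1 + A z) / (1 + B z)\<close> is an open convex set \<open>K\<close>, and
  \<open>g + c z g' \<in> K\<close> on the disc with \<open>Re c \<ge> 0\<close> forces \<open>g \<in> K\<close>: if \<open>g(z) \<notin> K\<close>, maximise over the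
  disc of radius \<open>|z|\<close> the real part of \<open>g\<close> in a direction separating \<open>g(z)\<close> from \<open>K\<close>. If \<open>y\<close> is a
  maximum point, the spiral \<open>y exp(t c)\<close>, \<open>t \<le> 0\<close>, stays in that disc, so the derivative \<open>c y g'(y)\<close>
  of \<open>g\<close> along it at \<open>t = 0\<close> has a nonnegative component in that direction; hence
  \<open>g(y) + c y g'(y) \<notin> K\<close>. Finally, the expression for \<open>\<mu>\<^sub>1\<close> is a convex combination of \<open>g\<close> and the
  expression for \<open>\<mu>\<^sub>2\<close>.
\<close>

section \<open>First-order differential expressions with values in a convex set\<close>

lemma convex_range_first_order:
  fixes g :: "complex \<Rightarrow> complex" and K :: "complex set" and c :: complex
  assumes holg: "g holomorphic_on ball 0 R"
    and K: "open K" "convex K"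
    and c: "Re c \<ge> 0"
    and F: "\<And>z. z \<in> ball 0 R \<Longrightarrow> g z + c * (z * deriv g z) \<in> K"
    and z: "z \<in> ball 0 R"
  shows "g z \<in> K"
proof (rule ccontr)
  assume notin: "g z \<notin> K"
  have "K \<noteq> {}" using F[OF z] by auto
  moreover have "K \<inter> {g z} = {}" using notin by simp
  ultimately have "\<exists>a b. a \<noteq> 0 \<and> (\<forall>x\<in>K. a \<bullet> x \<le> b) \<and> (\<forall>x\<in>{g z}. a \<bullet> x \<ge> b)"
    by (intro separating_hyperplane_sets K) simp_all
  then obtain a b where ab: "a \<noteq> 0" "\<And>x. x \<in> K \<Longrightarrow> a \<bullet> x \<le> b" "b \<le> a \<bullet> g z"
    by blast
  \<comment> \<open>Separation is only weak. Since \<open>K\<close> is open, \<open>x\<close> can be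
    pushed inside \<open>K\<close> in the direction \<open>a\<close>, so it does not attain the
    bound \<open>b\<close>.\<close>
  have strict: "a \<bullet> x < b" if "x \<in> K" for x
  proof -
    obtain e where e: "e > 0" "cball x e \<subseteq> K"
      using \<open>x \<in> K\<close> K(1) by (meson open_contains_cball)
    have "x + (e / norm a) *\<^sub>R a \<in> cball x e"
      using e ab(1) by (simp add: dist_norm)
    then have "a \<bullet> (x + (e / norm a) *\<^sub>R a) \<le> b" using ab(2) e by auto
    moreover have "a \<bullet> ((e / norm a) *\<^sub>R a) > 0"
      using e ab(1) by simp
    ultimately show ?thesis by (simp add: inner_add_right)
  qed
  have sub: "cball 0 (norm z) \<subseteq> ball (0::complex) R"
    using z by auto
  have "continuous_on (cball 0 (norm z)) (\<lambda>x. a \<bullet> g x)"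
    using holomorphic_on_imp_continuous_on[OF holg] continuous_on_subset sub
    by (intro continuous_intros) blast
  then obtain y where y: "y \<in> cball 0 (norm z)" "\<And>x. x \<in> cball 0 (norm z) \<Longrightarrow> a \<bullet> g x \<le> a \<bullet> g y"
    using continuous_attains_sup[of "cball (0::complex) (norm z)" "\<lambda>x. a \<bullet> g x"] by auto
  have yR: "y \<in> ball 0 R" using y(1) sub by auto
  define h where "h t = a \<bullet> g (y * exp (of_real t * c))" for t :: real
  have "(g has_field_derivative deriv g y) (at (y * exp (of_real 0 * c)))"
    using holg yR holomorphic_derivI by fastforce
  moreover have "((\<lambda>t. y * exp (of_real t * c)) has_vector_derivative y * c) (at 0)"
    by (auto intro!: derivative_eq_intros has_vector_derivative_real_field)
  ultimately have "((\<lambda>t. g (y * exp (of_real t * c))) has_vector_derivative y * c * deriv g y) (at 0)"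
    using field_vector_diff_chain_at[unfolded o_def] by blast
  then have "(h has_real_derivative a \<bullet> (y * c * deriv g y)) (at 0)"
    unfolding h_def has_real_derivative_iff_has_vector_derivative
    by (rule bounded_linear.has_vector_derivative[OF bounded_linear_inner_right])
  moreover have "h (0 - t) \<le> h 0" if "t > 0" for t
  proof -
    have "norm (exp (of_real (-t) * c)) \<le> 1"
      using c that by (simp add: norm_exp_eq_Re)
    then have "norm y * norm (exp (of_real (-t) * c)) \<le> norm y"
      by (simp add: mult_left_le)
    then have "y * exp (of_real (-t) * c) \<in> cball 0 (norm z)"
      using y(1) by (simp add: norm_mult)
    from y(2)[OF this] show ?thesis by (simp add: h_def)
  qed
  \<comment> \<open>Only \<open>t < 0\<close> is controlled, so just the sign of the derivative
    follows: were it negative, \<open>h\<close> would exceed \<open>h 0\<close> immediately to the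
    left of \<open>0\<close>.\<close>
  ultimately have "a \<bullet> (y * c * deriv g y) \<ge> 0"
    by (meson DERIV_neg_dec_left dense linorder_not_less)
  moreover have "a \<bullet> (g y + c * (y * deriv g y)) < b"
    using strict F yR by blast
  moreover have "a \<bullet> g y \<ge> b" using y(2)[of z] ab(3) by auto
  ultimately show False by (simp add: inner_add_right mult_ac)
qed

section \<open>Images of the disc under (1 + A z) / (1 + B z)\<close>

text \<open>For \<open>-1 \<le> B < A \<le> 1\<close> this is the image of the unit disc under (1 +
  A z) / (1 + B z): the inverse map is (w - 1) / (A - B w), and its modulus is compared with 1 after
  clearing the denominator. This form covers the half-plane \<open>B = -1\<close> together with the
  discs.\<close>

definition janowski_domain :: "real \<Rightarrow> real \<Rightarrow> complex set" where
  "janowski_domain A B = {w. norm (w - 1) < norm (of_real A - of_real B * w)}"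

lemma open_janowski_domain: "open (janowski_domain A B)"
  unfolding janowski_domain_def by (intro open_Collect_less continuous_intros)

lemma one_plus_mult_nonzero:
  fixes z :: complex
  assumes "\<bar>B\<bar> \<le> 1" "norm z < 1"
  shows "1 + of_real B * z \<noteq> 0"
proof
  assume "1 + of_real B * z = 0"
  then have "norm (of_real B * z) = 1"
    by (metis add_eq_0_iff norm_minus_cancel norm_one)
  moreover have "norm (of_real B * z) \<le> 1 * norm z"
    unfolding norm_mult norm_of_real using assms by (intro mult_right_mono) auto
  ultimately show False using assms by simp
qed

lemma subordinate_janowski_iff:
  assumes AB: "-1 \<le> B" "B < A" "A \<le> 1"
  shows "F \<prec>\<^sub>s (\<lambda>z. (1 + of_real A * z) / (1 + of_real B * z)) \<longleftrightarrow>
         F holomorphic_on unit_disc \<and> F 0 = 1 \<and> F ` unit_disc \<subseteq> janowski_domain A B"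
    (is "?L \<longleftrightarrow> ?R")
proof
  assume ?L
  then obtain w where w: "F holomorphic_on unit_disc" "w 0 = 0"
      "\<And>z. z \<in> unit_disc \<Longrightarrow> norm (w z) < 1"
      "\<And>z. z \<in> unit_disc \<Longrightarrow> F z = (1 + of_real A * w z) / (1 + of_real B * w z)"
    unfolding subordinate_def by blast
  have "F z \<in> janowski_domain A B" if z: "z \<in> unit_disc" for z
  proof -
    have nz: "1 + of_real B * w z \<noteq> 0"
      using one_plus_mult_nonzero w(3)[OF z] AB by simp
    have "F z - 1 = of_real (A - B) * w z / (1 + of_real B * w z)"
      using nz by (simp add: w(4)[OF z] field_simps)
    moreover have "of_real A - of_real B * F z = of_real (A - B) / (1 + of_real B * w z)"
      using nz by (simp add: w(4)[OF z] field_simps)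
    ultimately show ?thesis
      using nz AB w(3)[OF z] unfolding janowski_domain_def
      by (simp add: norm_divide norm_mult divide_strict_right_mono del: of_real_diff)
  qed
  then show ?R using w(1,2) w(4)[of 0] by auto
next
  assume R: ?R
  define w where "w z = (F z - 1) / (of_real A - of_real B * F z)" for z
  have J: "norm (F z - 1) < norm (of_real A - of_real B * F z)" if "z \<in> unit_disc" for z
    using R that unfolding janowski_domain_def by blast
  have nz: "of_real A - of_real B * F z \<noteq> 0" if "z \<in> unit_disc" for z
    using J[OF that] by auto
  have w1: "norm (w z) < 1" if "z \<in> unit_disc" for z
    using J[OF that] nz[OF that] by (simp add: w_def norm_divide)
  have "w holomorphic_on unit_disc"
    unfolding w_def using R nz by (intro holomorphic_intros) auto
  moreover have "(\<lambda>z. (1 + of_real A * z) / (1 + of_real B * z)) holomorphic_on unit_disc"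
    using AB one_plus_mult_nonzero by (intro holomorphic_intros) auto
  moreover have "F z = (1 + of_real A * w z) / (1 + of_real B * w z)" if z: "z \<in> unit_disc" for z
  proof -
    have "1 + of_real A * w z = of_real (A - B) * F z / (of_real A - of_real B * F z)"
      using nz[OF z] by (simp add: w_def field_simps)
    moreover have "1 + of_real B * w z = of_real (A - B) / (of_real A - of_real B * F z)"
      using nz[OF z] by (simp add: w_def field_simps)
    moreover have "complex_of_real (A - B) \<noteq> 0"
      using AB by (simp del: of_real_diff)
    ultimately show ?thesis using nz[OF z] by (simp del: of_real_diff)
  qed
  ultimately show ?L
    unfolding subordinate_def using R w1 by (intro conjI exI[of _ w]) (auto simp: w_def)
qed

lemma janowski_domain_iff:
  "w \<in> janowski_domain A B \<longleftrightarrow>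
     (1 - B\<^sup>2) * (norm w)\<^sup>2 - 2 * (1 - A * B) * Re w + 1 - A\<^sup>2 < 0"
proof -
  have "w \<in> janowski_domain A B \<longleftrightarrow> (norm (w - 1))\<^sup>2 < (norm (of_real A - of_real B * w))\<^sup>2"
    unfolding janowski_domain_def
    by (simp add: power_mono_iff flip: not_le)
  also have "\<dots> \<longleftrightarrow> (1 - B\<^sup>2) * (norm w)\<^sup>2 - 2 * (1 - A * B) * Re w + 1 - A\<^sup>2 < 0"
    unfolding cmod_power2 by (simp add: power2_eq_square algebra_simps)
  finally show ?thesis .
qed

text \<open>The set is a sublevel set of a quadratic function with leading coefficient
  \<open>1 - B\<^sup>2 \<ge> 0\<close>. Its convexity is made explicit by |u x + v y|^2 = u |x|^2 +
  v |y|^2 - u v |x - y|^2 for u + v = 1.\<close>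

lemma convex_janowski_domain:
  assumes "\<bar>B\<bar> \<le> 1"
  shows "convex (janowski_domain A B)"
proof (rule convexI)
  fix x y :: complex and u v :: real
  assume xy: "x \<in> janowski_domain A B" "y \<in> janowski_domain A B"
    and uv: "0 \<le> u" "0 \<le> v" "u + v = 1"
  define \<phi> where "\<phi> w = (1 - B\<^sup>2) * (norm w)\<^sup>2 - 2 * (1 - A * B) * Re w + 1 - A\<^sup>2" for w :: complex
  have v: "v = 1 - u" using uv by simp
  have "\<phi> (u *\<^sub>R x + v *\<^sub>R y) = u * \<phi> x + v * \<phi> y - u * v * ((1 - B\<^sup>2) * (norm (x - y))\<^sup>2)"
    unfolding \<phi>_def v cmod_power2 by (simp add: power2_eq_square algebra_simps)
  moreover have "1 - B\<^sup>2 \<ge> 0"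
    using assms by (simp add: abs_square_le_1)
  then have "u * v * ((1 - B\<^sup>2) * (norm (x - y))\<^sup>2) \<ge> 0"
    using uv by simp
  moreover have "u * \<phi> x + v * \<phi> y < 0"
    using xy uv convex_bound_lt[of "\<phi> x" 0 "\<phi> y" u v] by (simp add: janowski_domain_iff \<phi>_def)
  ultimately have "\<phi> (u *\<^sub>R x + v *\<^sub>R y) < 0" by linarith
  then show "u *\<^sub>R x + v *\<^sub>R y \<in> janowski_domain A B"
    by (simp add: janowski_domain_iff \<phi>_def)
qed

lemma janowski_domain_mono:
  assumes "-1 \<le> B\<^sub>1" "B\<^sub>1 \<le> B\<^sub>2" "B\<^sub>2 < A\<^sub>2" "A\<^sub>2 \<le> A\<^sub>1" "A\<^sub>1 \<le> 1"
  shows "janowski_domain A\<^sub>2 B\<^sub>2 \<subseteq> janowski_domain A\<^sub>1 B\<^sub>1"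
proof
  fix w assume "w \<in> janowski_domain A\<^sub>2 B\<^sub>2"
  then have less: "norm (w - 1) < norm (of_real A\<^sub>2 - of_real B\<^sub>2 * w)"
    by (simp add: janowski_domain_def)
  \<comment> \<open>Mapping the disc by the second map and then by the inverse of the first gives
    \<open>u\<close> \<mapsto> \<open>(A\<^sub>2 - B\<^sub>2) * u / (A\<^sub>1 - B\<^sub>1 + P *
    u)\<close>. The bound on |P| below is what makes this a self-map of the disc.\<close>
  define P where "P = A\<^sub>1 * B\<^sub>2 - B\<^sub>1 * A\<^sub>2"
  have "A\<^sub>1 - B\<^sub>1 - (A\<^sub>2 - B\<^sub>2) - P = (A\<^sub>1 - A\<^sub>2) * (1 - B\<^sub>2) + (B\<^sub>2 - B\<^sub>1) * (1 - A\<^sub>2)"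
    unfolding P_def by (simp add: algebra_simps)
  also have "\<dots> \<ge> 0" using assms by simp
  finally have P1: "A\<^sub>1 - B\<^sub>1 - (A\<^sub>2 - B\<^sub>2) - P \<ge> 0" .
  have "A\<^sub>1 - B\<^sub>1 - (A\<^sub>2 - B\<^sub>2) + P = (A\<^sub>1 - A\<^sub>2) * (1 + B\<^sub>2) + (B\<^sub>2 - B\<^sub>1) * (1 + A\<^sub>2)"
    unfolding P_def by (simp add: algebra_simps)
  also have "\<dots> \<ge> 0" using assms by simp
  finally have P2: "\<bar>P\<bar> \<le> (A\<^sub>1 - B\<^sub>1) - (A\<^sub>2 - B\<^sub>2)" using P1 by linarith
  define v where "v = of_real A\<^sub>2 - of_real B\<^sub>2 * w"
  have "of_real (A\<^sub>1 - B\<^sub>1) * v = of_real (A\<^sub>2 - B\<^sub>2) * (of_real A\<^sub>1 - of_real B\<^sub>1 * w)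
          - of_real P * (w - 1)"
    unfolding v_def P_def by (simp add: algebra_simps)
  then have "norm (of_real (A\<^sub>1 - B\<^sub>1) * v) \<le>
      norm (of_real (A\<^sub>2 - B\<^sub>2) * (of_real A\<^sub>1 - of_real B\<^sub>1 * w)) + norm (of_real P * (w - 1))"
    by (metis norm_triangle_ineq4)
  then have "(A\<^sub>1 - B\<^sub>1) * norm v \<le>
      (A\<^sub>2 - B\<^sub>2) * norm (of_real A\<^sub>1 - of_real B\<^sub>1 * w) + \<bar>P\<bar> * norm (w - 1)"
    unfolding norm_mult norm_of_real using assms by simp
  moreover have "\<bar>P\<bar> * norm (w - 1) \<le> ((A\<^sub>1 - B\<^sub>1) - (A\<^sub>2 - B\<^sub>2)) * norm (w - 1)"
    using P2 by (intro mult_right_mono) auto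
  moreover have "(A\<^sub>1 - B\<^sub>1) * norm (w - 1) < (A\<^sub>1 - B\<^sub>1) * norm v"
    using less assms by (simp add: v_def)
  ultimately have "(A\<^sub>2 - B\<^sub>2) * norm (w - 1) < (A\<^sub>2 - B\<^sub>2) * norm (of_real A\<^sub>1 - of_real B\<^sub>1 * w)"
    by (simp add: left_diff_distrib)
  then show "w \<in> janowski_domain A\<^sub>1 B\<^sub>1"
    using assms by (simp add: janowski_domain_def)
qed

section \<open>Logarithmic differentiation of the defining expression\<close>

text \<open>Dividing the power series by z^p leaves s(z) = 1 + z^n r(z). It removes the singularity
  at the origin: near \<open>0\<close> the quotient z^p / f is 1 / s, with value 1 at
  \<open>0\<close> because \<open>n \<ge> 1\<close>.\<close>

lemma class_A_factor:
  assumes f: "f \<in> class_A p n" and n: "n \<ge> 1"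
  obtains s where "s holomorphic_on unit_disc" "s 0 = 1"
    "\<And>z. z \<in> unit_disc \<Longrightarrow> f z = z ^ p * s z"
proof -
  from f obtain a :: "nat \<Rightarrow> complex" where a: "\<And>z. z \<in> unit_disc \<Longrightarrow>
      (\<lambda>j. a (n + j + p) * z ^ (n + j + p)) sums (f z - z ^ p)"
    unfolding class_A_def by blast
  define r where "r z = (if z = 0 then a (n + p) else (f z - z ^ p) / z ^ (n + p))" for z
  have "(\<lambda>j. a (n + j + p) * (z - 0) ^ j) sums r z" if z: "z \<in> ball 0 1" for z
  proof (cases "z = 0")
    case True
    then show ?thesis using powser_sums_zero[of "\<lambda>j. a (n + j + p)"] by (simp add: r_def)
  next
    case False
    then show ?thesis
      using sums_divide[OF a[OF z], of "z ^ (n + p)"] by (simp add: r_def power_add)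
  qed
  then have "r holomorphic_on unit_disc" by (rule power_series_holomorphic)
  then have "(\<lambda>z. 1 + z ^ n * r z) holomorphic_on unit_disc" by (intro holomorphic_intros)
  moreover have "f z = z ^ p * (1 + z ^ n * r z)" if z: "z \<in> unit_disc" for z
  proof (cases "z = 0")
    case True
    have "(\<lambda>j. a (n + j + p) * z ^ (n + j + p)) = (\<lambda>j. 0)"
      using True n by auto
    then have "f z - z ^ p = 0"
      using a[OF z] sums_unique2[OF _ sums_zero] by metis
    then show ?thesis using True n by simp
  next
    case False
    then show ?thesis by (simp add: r_def power_add field_simps)
  qed
  ultimately show thesis using that[of "\<lambda>z. 1 + z ^ n * r z"] n by simp
qed

text \<open>
  Near the origin this is logarithmic differentiation. Away from it the principal power need not
  obey the chain rule pointwise (the quotient might meet the branch cut), so the identity is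
  carried over by analytic continuation.
\<close>

lemma class_N_expression_eq:
  fixes \<kappa> \<mu> :: complex
  assumes f: "f \<in> class_A p n" and p: "p \<ge> 1" and n: "n \<ge> 1" and \<kappa>: "\<kappa> \<noteq> 0"
    and holg: "(\<lambda>z. pquot p f z powr \<kappa>) holomorphic_on unit_disc"
    and holF: "(\<lambda>z. (1 + \<mu>) * pquot p f z powr \<kappa> - \<mu> * log_deriv_quot p f z * pquot p f z powr \<kappa>)
                 holomorphic_on unit_disc"
    and z: "z \<in> unit_disc"
  shows "(1 + \<mu>) * pquot p f z powr \<kappa> - \<mu> * log_deriv_quot p f z * pquot p f z powr \<kappa> =
         pquot p f z powr \<kappa> + \<mu> / (\<kappa> * of_nat p) * (z * deriv (\<lambda>z. pquot p f z powr \<kappa>) z)"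
proof -
  define g where "g = (\<lambda>z. pquot p f z powr \<kappa>)"
  obtain s where s: "s holomorphic_on unit_disc" "s 0 = 1"
      "\<And>z. z \<in> unit_disc \<Longrightarrow> f z = z ^ p * s z"
    using class_A_factor f n by blast
  \<comment> \<open>On this neighbourhood of \<open>0\<close> the values of 1 / s also have positive
    real part, so they avoid the branch cut of the principal power.\<close>
  define V where "V = {z \<in> unit_disc. s z \<in> {w. Re w > 0}}"
  have openV: "open V"
    unfolding V_def vimage_def[symmetric] Collect_conj_eq Collect_mem_eq
    using continuous_open_preimage[OF holomorphic_on_imp_continuous_on[OF s(1)] open_ball open_halfspace_Re_gt]
    by (simp add: vimage_def)
  have near: "(1 + \<mu>) * g x - \<mu> * log_deriv_quot p f x * g x =
      g x + \<mu> / (\<kappa> * of_nat p) * (x * deriv g x)" if x: "x \<in> V" for x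
  proof -
    have xD: "x \<in> unit_disc" and Re: "Re (s x) > 0" using x by (auto simp: V_def)
    have quot: "pquot p f y = inverse (s y)" if "y \<in> V" for y
      using that s(2) s(3)[of y] by (cases "y = 0") (auto simp: V_def pquot_def field_simps)
    have snz: "s x \<noteq> 0" using Re by auto
    have ds: "(s has_field_derivative deriv s x) (at x)"
      using s(1) xD holomorphic_derivI open_ball by blast
    have "Re (inverse (s x)) > 0"
      using Re by (simp add: Re_complex_div_gt_0 inverse_eq_divide)
    then have "inverse (s x) \<notin> \<real>\<^sub>\<le>\<^sub>0"
      by (auto simp: complex_nonpos_Reals_iff)
    then have "((\<lambda>y. inverse (s y) powr \<kappa>) has_field_derivative
        \<kappa> * inverse (s x) powr (\<kappa> - 1) * (- (inverse (s x) * deriv s x * inverse (s x)))) (at x)"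
      by (intro DERIV_chain2[OF has_field_derivative_powr DERIV_inverse'[OF ds]] snz)
    then have "(g has_field_derivative
        \<kappa> * inverse (s x) powr (\<kappa> - 1) * (- (inverse (s x) * deriv s x * inverse (s x)))) (at x)"
      by (rule has_field_derivative_transform_within_open[OF _ openV x]) (simp add: g_def quot)
    then have dg: "deriv g x = - (\<kappa> * g x * deriv s x / s x)"
      using snz by (simp add: DERIV_imp_deriv g_def quot[OF x] powr_diff field_simps)
    have "((\<lambda>y. y ^ p * s y) has_field_derivative
        of_nat p * x ^ (p - 1) * s x + x ^ p * deriv s x) (at x)"
      using ds by (auto intro!: derivative_eq_intros)
    then have "(f has_field_derivative of_nat p * x ^ (p - 1) * s x + x ^ p * deriv s x) (at x)"
      by (rule has_field_derivative_transform_within_open[OF _ open_ball xD]) (simp add: s(3))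
    then have df: "deriv f x = of_nat p * x ^ (p - 1) * s x + x ^ p * deriv s x"
      by (rule DERIV_imp_deriv)
    have ldq: "log_deriv_quot p f x = 1 + x * deriv s x / (of_nat p * s x)"
    proof (cases "x = 0")
      case False
      have "x ^ p = x * x ^ (p - 1)" using p by (simp add: power_eq_if)
      then show ?thesis
        using False p snz by (simp add: log_deriv_quot_def df s(3)[OF xD] field_simps)
    qed (simp add: log_deriv_quot_def)
    \<comment> \<open>With x g' = -\<kappa> g x s' / s, both sides become g - \<mu> g x s' / (p
      s).\<close>
    show ?thesis
      unfolding dg ldq using p snz \<kappa> by (simp add: field_simps)
  qed
  have "(\<lambda>z. g z + \<mu> / (\<kappa> * of_nat p) * (z * deriv g z)) holomorphic_on unit_disc"
    using holg[folded g_def] by (intro holomorphic_intros holomorphic_deriv) auto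
  moreover have "V \<noteq> {}" "V \<subseteq> unit_disc"
    using s(2) by (auto simp: V_def intro!: exI[of _ 0])
  ultimately show ?thesis
    using analytic_continuation_open[OF openV open_ball _ _ _ holF[folded g_def] _ _ z] near
    unfolding g_def by blast
qed

section \<open>The inclusion of the classes\<close>

theorem theorem2p4:
  fixes p n :: nat and \<mu>\<^sub>1 \<mu>\<^sub>2 \<alpha> \<beta> A\<^sub>1 A\<^sub>2 B\<^sub>1 B\<^sub>2 :: real
  assumes "p \<ge> 1" and "n \<ge> 1"
    and "0 \<le> \<mu>\<^sub>1" and "\<mu>\<^sub>1 \<le> \<mu>\<^sub>2"
    and "\<alpha> \<ge> 0"
    and "complex_of_real \<alpha> + \<i> * complex_of_real \<beta> \<noteq> 0"
    and "-1 \<le> B\<^sub>1" and "B\<^sub>1 \<le> B\<^sub>2" and "B\<^sub>2 < A\<^sub>2" and "A\<^sub>2 \<le> A\<^sub>1" and "A\<^sub>1 \<le> 1"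
  shows "class_N p n (complex_of_real \<mu>\<^sub>2) \<alpha> \<beta> A\<^sub>2 B\<^sub>2
         \<subseteq> class_N p n (complex_of_real \<mu>\<^sub>1) \<alpha> \<beta> A\<^sub>1 B\<^sub>1"
proof
  fix f assume f: "f \<in> class_N p n (complex_of_real \<mu>\<^sub>2) \<alpha> \<beta> A\<^sub>2 B\<^sub>2"
  define \<kappa> where "\<kappa> = complex_of_real \<alpha> + \<i> * complex_of_real \<beta>"
  define g where "g = (\<lambda>z. pquot p f z powr \<kappa>)"
  define F where "F \<mu> = (\<lambda>z. (1 + complex_of_real \<mu>) * g z - of_real \<mu> * log_deriv_quot p f z * g z)" for \<mu>
  have fA: "f \<in> class_A p n" and holg: "g holomorphic_on unit_disc"
    and sub: "F \<mu>\<^sub>2 \<prec>\<^sub>s (\<lambda>z. (1 + of_real A\<^sub>2 * z) / (1 + of_real B\<^sub>2 * z))"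
    using f unfolding class_N_def F_def g_def \<kappa>_def by auto
  have F2: "F \<mu>\<^sub>2 holomorphic_on unit_disc" "F \<mu>\<^sub>2 ` unit_disc \<subseteq> janowski_domain A\<^sub>2 B\<^sub>2"
    using sub subordinate_janowski_iff[of B\<^sub>2 A\<^sub>2] assms by auto
  define c where "c = of_real \<mu>\<^sub>2 / (\<kappa> * of_nat p)"
  have eq: "F \<mu>\<^sub>2 z = g z + c * (z * deriv g z)" if "z \<in> unit_disc" for z
    using class_N_expression_eq[OF fA assms(1,2), of \<kappa> "of_real \<mu>\<^sub>2" z] assms(6) holg F2(1) that
    unfolding F_def g_def c_def \<kappa>_def by blast
  have convex: "convex (janowski_domain A\<^sub>2 B\<^sub>2)"
    using assms by (intro convex_janowski_domain) auto
  \<comment> \<open>The real part of 1 / \<kappa> is \<alpha> / (\<alpha>^2 + \<beta>^2), so the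
    sign of \<alpha> decides the sign of \<open>Re c\<close>.\<close>
  have "c = of_real (\<mu>\<^sub>2 / real p) * inverse \<kappa>"
    by (simp add: c_def field_simps)
  then have "Re c = \<mu>\<^sub>2 / real p * Re (inverse \<kappa>)"
    by simp
  moreover have "Re (inverse \<kappa>) \<ge> 0" using assms(5) by (simp add: \<kappa>_def)
  moreover have "\<mu>\<^sub>2 / real p \<ge> 0" using assms by simp
  ultimately have "Re c \<ge> 0" by (metis mult_nonneg_nonneg)
  then have gK: "g z \<in> janowski_domain A\<^sub>2 B\<^sub>2" if "z \<in> unit_disc" for z
    using convex_range_first_order[OF holg open_janowski_domain convex] eq F2(2) that
    by (metis image_subset_iff)
  \<comment> \<open>If \<open>\<mu>\<^sub>2 = 0\<close>, then \<open>\<mu>\<^sub>1 = 0\<close> and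
    division by zero gives \<open>t = 0\<close>, so \<open>\<mu>\<^sub>1 = t * \<mu>\<^sub>2\<close>
    holds in that case too.\<close>
  define t where "t = \<mu>\<^sub>1 / \<mu>\<^sub>2"
  have t: "0 \<le> t" "t \<le> 1" "\<mu>\<^sub>1 = t * \<mu>\<^sub>2"
    using assms by (auto simp: t_def divide_le_eq_1)
  \<comment> \<open>\<open>F\<close> is affine in its parameter and \<open>F 0\<close> is
    \<open>g\<close>.\<close>
  have F1: "F \<mu>\<^sub>1 z = (1 - t) *\<^sub>R g z + t *\<^sub>R F \<mu>\<^sub>2 z" for z
    unfolding F_def t(3) scaleR_conv_of_real by (simp add: algebra_simps)
  have "F \<mu>\<^sub>1 z \<in> janowski_domain A\<^sub>1 B\<^sub>1" if "z \<in> unit_disc" for z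
  proof -
    have "F \<mu>\<^sub>1 z \<in> janowski_domain A\<^sub>2 B\<^sub>2"
      unfolding F1 using t gK[OF that] F2(2) that by (intro convexD[OF convex]) auto
    then show ?thesis using janowski_domain_mono[of B\<^sub>1 B\<^sub>2 A\<^sub>2 A\<^sub>1] assms by blast
  qed
  moreover have "F \<mu>\<^sub>1 holomorphic_on unit_disc"
    unfolding F1 scaleR_conv_of_real by (intro holomorphic_intros holg F2(1))
  moreover have "F \<mu>\<^sub>1 0 = 1" by (simp add: F_def g_def pquot_def log_deriv_quot_def)
  ultimately have "F \<mu>\<^sub>1 \<prec>\<^sub>s (\<lambda>z. (1 + of_real A\<^sub>1 * z) / (1 + of_real B\<^sub>1 * z))"
    using subordinate_janowski_iff[of B\<^sub>1 A\<^sub>1] assms by auto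
  then show "f \<in> class_N p n (complex_of_real \<mu>\<^sub>1) \<alpha> \<beta> A\<^sub>1 B\<^sub>1"
    using fA holg unfolding class_N_def F_def g_def \<kappa>_def by auto
qed

end
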